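(* Let $n\geq 2$ be an integer. The braiding on the Nichols algebra $\mathcal{B}_{C_n}$ is of Cartan type if and only if $n=p$ is prime.
   Context: Let $k$ be a field of characteristic zero containing a primitive $n$-th root of unity $\xi$, and let $C_n$ be the cyclic group of order $n$ with generator $g$. Let $Y_{C_n}$ be the Yetter--Drinfeld module over $kC_n$ with basis $s_1,\ldots,s_{n-1}$, action $g\cdot s_i=\xi s_i$ and coaction (grading) $\delta(s_i)=g^i\otimes s_i$. Its braiding is $\Psi(s_i\otimes s_j)=(g^i\cdot s_j)\otimes s_i=\xi^i s_j\otimes s_i$, i.e. it is of diagonal type with $q_{ij}=\xi^i$ for $1\leq i,j\leq n-1$. $\mathcal{B}_{C_n}:=\mathcal{B}(Y_{C_n})$ denotes the Nichols algebra of $Y_{C_n}$. A braiding of diagonal type with matrix $(q_{ij})_{i,j\in I}$ (so $\Psi(s_i\otimes s_j)=q_{ij}s_j\otimes s_i$) is of Cartan type if $q_{ii}\neq 1$ for all $i\in I$ and, for all $i\neq j$, the number $$a_{ij}=-\min\{r\geq 0\mid q_{ii}^r q_{ij}q_{ji}=1\}$$ exists and satisfies $0\leq -a_{ij}<\operatorname{ord} q_{ii}$ (so that, with $a_{ii}=2$, $(a_{ij})$ is a generalized Cartan matrix). *)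

theory Defs
  imports
    Complex_Main
    "HOL-Library.Poly_Mapping"
    "HOL-Library.Extended_Nat"
    "HOL-Computational_Algebra.Primes"
    "HOL-Algebra.Elementary_Groups"
begin

section \<open>Vector spaces with a chosen basis\<close>

text \<open>
  A vector space with basis \<open>B\<close> is the set of those finitely supported functions on the
  ambient index type whose support lies in \<open>B\<close>. The tensor product of the spaces with bases
  \<open>B\<close> and \<open>C\<close> is the space with basis \<open>B \<times> C\<close>.
\<close>

definition scale :: "'k::field \<Rightarrow> ('b \<Rightarrow>\<^sub>0 'k) \<Rightarrow> ('b \<Rightarrow>\<^sub>0 'k)" where
  "scale c v = Poly_Mapping.map ((*) c) v"

definition bvec :: "'b \<Rightarrow> ('b \<Rightarrow>\<^sub>0 'k::field)" where
  "bvec b = Poly_Mapping.single b 1"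

definition lin_space :: "'b set \<Rightarrow> ('b \<Rightarrow>\<^sub>0 'k::field) set" where
  "lin_space B = {v. Poly_Mapping.keys v \<subseteq> B}"

text \<open>The linear map with prescribed values \<open>f b\<close> on the basis vectors \<open>bvec b\<close>:\<close>

definition lin_ext :: "('b \<Rightarrow> ('c \<Rightarrow>\<^sub>0 'k::field)) \<Rightarrow> ('b \<Rightarrow>\<^sub>0 'k) \<Rightarrow> ('c \<Rightarrow>\<^sub>0 'k)" where
  "lin_ext f v = (\<Sum>b\<in>Poly_Mapping.keys v. scale (Poly_Mapping.lookup v b) (f b))"

definition tensor :: "('b \<Rightarrow>\<^sub>0 'k::field) \<Rightarrow> ('c \<Rightarrow>\<^sub>0 'k) \<Rightarrow> ('b \<times> 'c \<Rightarrow>\<^sub>0 'k)" where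
  "tensor v w = lin_ext (\<lambda>b. lin_ext (\<lambda>c. bvec (b, c)) w) v"

lemma lookup_scale [simp]: "Poly_Mapping.lookup (scale c v) b = c * Poly_Mapping.lookup v b"
  unfolding scale_def by transfer (auto simp: when_def)

lemma vector_space_scale: "vector_space scale"
  by unfold_locales (auto intro!: poly_mapping_eqI simp: lookup_add algebra_simps)

lemma lin_ext_bvec [simp]: "lin_ext f (bvec b) = f b"
  by (simp add: lin_ext_def bvec_def poly_mapping_eq_iff fun_eq_iff)

lemma lin_ext_single [simp]: "lin_ext f (Poly_Mapping.single b c) = scale c (f b)"
  by (auto simp add: lin_ext_def poly_mapping_eq_iff fun_eq_iff)

lemma tensor_bvec [simp]: "tensor (bvec b) (bvec c) = bvec (b, c)"
  by (simp add: tensor_def)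


section \<open>Yetter--Drinfeld modules over a group algebra\<close>

text \<open>
  Every comodule over a group algebra has a basis of homogeneous elements. So we store a basis
  \<open>s\<^sub>i\<close>, the vectors \<open>h \<cdot> s\<^sub>i\<close> and the degrees of the \<open>s\<^sub>i\<close>; the coaction is
  \<open>s\<^sub>i \<mapsto> deg i \<otimes> s\<^sub>i\<close>.
\<close>

record (overloaded) ('g, 'i, 'k) yd =
  basis :: "'i set"
  act :: "'g \<Rightarrow> 'i \<Rightarrow> ('i \<Rightarrow>\<^sub>0 'k)"
  deg :: "'i \<Rightarrow> 'g"

locale yetter_drinfeld = group G
  for G :: "'g monoid" (structure) and Y :: "('g, 'i, 'k::field) yd" +
  assumes deg_closed: "i \<in> basis Y \<Longrightarrow> deg Y i \<in> carrier G"
    and act_closed: "\<lbrakk>h \<in> carrier G; i \<in> basis Y\<rbrakk> \<Longrightarrow> act Y h i \<in> lin_space (basis Y)"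
    and act_one: "i \<in> basis Y \<Longrightarrow> act Y \<one> i = bvec i"
    and act_mult: "\<lbrakk>h \<in> carrier G; h' \<in> carrier G; i \<in> basis Y\<rbrakk>
          \<Longrightarrow> act Y (h \<otimes> h') i = lin_ext (act Y h) (act Y h' i)"
    and act_deg: "\<lbrakk>h \<in> carrier G; i \<in> basis Y\<rbrakk>
          \<Longrightarrow> act Y h i \<in> lin_space {j. deg Y j = h \<otimes> deg Y i \<otimes> inv h}"

text \<open>The braiding \<open>x \<otimes> y \<mapsto> (x\<^sub>(\<^sub>-\<^sub>1\<^sub>) \<cdot> y) \<otimes> x\<^sub>(\<^sub>0\<^sub>)\<close>:\<close>

definition braiding :: "('g, 'i, 'k::field) yd \<Rightarrow> ('i \<times> 'i \<Rightarrow>\<^sub>0 'k) \<Rightarrow> ('i \<times> 'i \<Rightarrow>\<^sub>0 'k)" where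
  "braiding Y = lin_ext (\<lambda>(i, j). tensor (act Y (deg Y i) j) (bvec i))"


section \<open>The Nichols algebra\<close>

text \<open>
  The basis of the tensor algebra \<open>T(Y)\<close> consists of the words in the basis of \<open>Y\<close>; it is a
  Yetter--Drinfeld module for the diagonal action and coaction.
\<close>

definition word_cons :: "'i \<times> 'i list \<Rightarrow> ('i list \<Rightarrow>\<^sub>0 'k::field)" where
  "word_cons = (\<lambda>(i, w). bvec (i # w))"

fun word_act :: "('g, 'i, 'k::field) yd \<Rightarrow> 'g \<Rightarrow> 'i list \<Rightarrow> ('i list \<Rightarrow>\<^sub>0 'k)" where
  "word_act Y h [] = bvec []"
| "word_act Y h (i # w) = lin_ext word_cons (tensor (act Y h i) (word_act Y h w))"

definition tensor_algebra :: "'g monoid \<Rightarrow> ('g, 'i, 'k::field) yd \<Rightarrow> ('g, 'i list, 'k) yd" where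
  "tensor_algebra G Y =
     \<lparr>basis = lists (basis Y),
      act = word_act Y,
      deg = (\<lambda>w. foldr (\<lambda>i h. deg Y i \<otimes>\<^bsub>G\<^esub> h) w \<one>\<^bsub>G\<^esub>)\<rparr>"

text \<open>
  \<open>braid_at Y m\<close> is \<open>\<Psi>\<close> applied to the tensor factors number \<open>m\<close> and \<open>m + 1\<close> (counting from 0),
  and \<open>to_front Y m\<close> is the composite \<open>\<Psi>\<^sub>0 \<circ> \<Psi>\<^sub>1 \<circ> \<dots> \<circ> \<Psi>\<^sub>m\<^sub>-\<^sub>1\<close>, which moves factor \<open>m\<close> to the front.
\<close>

definition braid_at :: "('g, 'i, 'k::field) yd \<Rightarrow> nat \<Rightarrow> 'i list \<Rightarrow> ('i list \<Rightarrow>\<^sub>0 'k)" where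
  "braid_at Y m w =
     lin_ext (\<lambda>(a, b). bvec (take m w @ [a, b] @ drop (m + 2) w))
       (braiding Y (bvec (w ! m, w ! (m + 1))))"

fun to_front :: "('g, 'i, 'k::field) yd \<Rightarrow> nat \<Rightarrow> 'i list \<Rightarrow> ('i list \<Rightarrow>\<^sub>0 'k)" where
  "to_front Y 0 w = bvec w"
| "to_front Y (Suc m) w = lin_ext (to_front Y m) (braid_at Y m w)"

text \<open>\<open>id \<otimes> f\<close> for an endomorphism \<open>f\<close> of \<open>T(Y)\<close>; only used on words of positive length.\<close>

fun id_tensor :: "('i list \<Rightarrow> ('i list \<Rightarrow>\<^sub>0 'k::field)) \<Rightarrow> 'i list \<Rightarrow> ('i list \<Rightarrow>\<^sub>0 'k)" where
  "id_tensor f [] = bvec []"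
| "id_tensor f (i # w) = lin_ext word_cons (tensor (bvec i) (f w))"

text \<open>
  The quantum symmetrizer \<open>S\<^sub>m = \<Sum>\<sigma>. \<Psi>\<^sub>\<sigma>\<close> on \<open>Y\<^sup>\<otimes>\<^sup>m\<close>, where \<open>\<sigma>\<close> runs over the symmetric group on
  \<open>m\<close> letters and \<open>\<Psi>\<^sub>\<sigma>\<close> is the product of the \<open>\<Psi>\<^sub>i\<close> along a reduced word of \<open>\<sigma>\<close>. Writing \<open>\<sigma>\<close>
  as an element of the stabilizer of the first position times a coset representative
  of minimal length gives
  \<open>S\<^sub>m\<^sub>+\<^sub>1 = (id \<otimes> S\<^sub>m) \<circ> (id + \<Psi>\<^sub>0 + \<Psi>\<^sub>0\<Psi>\<^sub>1 + \<dots> + \<Psi>\<^sub>0\<Psi>\<^sub>1\<cdots>\<Psi>\<^sub>m\<^sub>-\<^sub>1)\<close>.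
\<close>

fun quantum_sym :: "('g, 'i, 'k::field) yd \<Rightarrow> nat \<Rightarrow> 'i list \<Rightarrow> ('i list \<Rightarrow>\<^sub>0 'k)" where
  "quantum_sym Y 0 w = bvec w"
| "quantum_sym Y (Suc m) w =
     lin_ext (id_tensor (quantum_sym Y m)) (\<Sum>l\<le>m. to_front Y l w)"

text \<open>
  The Nichols algebra is \<open>B(Y) = T(Y) / J\<close>, where \<open>J\<close> is the direct sum of the kernels of all
  \<open>S\<^sub>m\<close>. Since \<open>S\<^sub>m\<close> maps \<open>Y\<^sup>\<otimes>\<^sup>m\<close> to itself, this is the kernel of their sum.
\<close>

definition nichols_ideal :: "('g, 'i, 'k::field) yd \<Rightarrow> ('i list \<Rightarrow>\<^sub>0 'k) set" where
  "nichols_ideal Y =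
     {t \<in> lin_space (lists (basis Y)). lin_ext (\<lambda>w. quantum_sym Y (length w) w) t = 0}"

text \<open>
  \<open>B(Y) \<otimes> B(Y)\<close> is the quotient of \<open>T(Y) \<otimes> T(Y)\<close> by \<open>J \<otimes> T(Y) + T(Y) \<otimes> J\<close>;
  its elements are represented by cosets.
\<close>

definition nichols_relations2 ::
    "('g, 'i, 'k::field) yd \<Rightarrow> ('i list \<times> 'i list \<Rightarrow>\<^sub>0 'k) set" where
  "nichols_relations2 Y =
     module.span scale
       ({tensor x y | x y. x \<in> nichols_ideal Y \<and> y \<in> lin_space (lists (basis Y))} \<union>
        {tensor x y | x y. x \<in> lin_space (lists (basis Y)) \<and> y \<in> nichols_ideal Y})"

definition nichols_class2 ::
    "('g, 'i, 'k::field) yd \<Rightarrow> ('i list \<times> 'i list \<Rightarrow>\<^sub>0 'k) \<Rightarrow> ('i list \<times> 'i list \<Rightarrow>\<^sub>0 'k) set" where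
  "nichols_class2 Y t = {t + r | r. r \<in> nichols_relations2 Y}"

text \<open>
  \<open>B(Y)\<close> is a quotient of \<open>T(Y)\<close> as a Yetter--Drinfeld module, so its braiding is induced by the
  braiding of \<open>T(Y)\<close>.
\<close>

definition nichols_braiding ::
    "'g monoid \<Rightarrow> ('g, 'i, 'k::field) yd \<Rightarrow>
     ('i list \<times> 'i list \<Rightarrow>\<^sub>0 'k) set \<Rightarrow> ('i list \<times> 'i list \<Rightarrow>\<^sub>0 'k) set" where
  "nichols_braiding G Y C = (\<Union>t\<in>C. nichols_class2 Y (braiding (tensor_algebra G Y) t))"


section \<open>Diagonal and Cartan type\<close>

text \<open>\<open>\<Psi>(s\<^sub>i \<otimes> s\<^sub>j) = q\<^sub>i\<^sub>j s\<^sub>j \<otimes> s\<^sub>i\<close> for the generators \<open>s\<^sub>i\<close> of the Nichols algebra:\<close>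

definition nichols_diagonal_type ::
    "'g monoid \<Rightarrow> ('g, 'i, 'k::field) yd \<Rightarrow> ('i \<Rightarrow> 'i \<Rightarrow> 'k) \<Rightarrow> bool" where
  "nichols_diagonal_type G Y q \<longleftrightarrow>
     (\<forall>i\<in>basis Y. \<forall>j\<in>basis Y.
        nichols_braiding G Y (nichols_class2 Y (tensor (bvec [i]) (bvec [j]))) =
        nichols_class2 Y (scale (q i j) (tensor (bvec [j]) (bvec [i]))))"

text \<open>The infimum of the empty set is \<open>\<infinity>\<close>.\<close>

definition mult_order :: "'k::field \<Rightarrow> enat" where
  "mult_order x = (INF m\<in>{m. m > 0 \<and> x ^ m = 1}. enat m)"

definition cartan_entry :: "('i \<Rightarrow> 'i \<Rightarrow> 'k::field) \<Rightarrow> 'i \<Rightarrow> 'i \<Rightarrow> int" where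
  "cartan_entry q i j =
     (if i = j then 2 else - int (LEAST r. q i i ^ r * q i j * q j i = 1))"

definition cartan_matrix_condition :: "'i set \<Rightarrow> ('i \<Rightarrow> 'i \<Rightarrow> 'k::field) \<Rightarrow> bool" where
  "cartan_matrix_condition I q \<longleftrightarrow>
     (\<forall>i\<in>I. q i i \<noteq> 1) \<and>
     (\<forall>i\<in>I. \<forall>j\<in>I. i \<noteq> j \<longrightarrow>
        (\<exists>r. q i i ^ r * q i j * q j i = 1) \<and>
        0 \<le> - cartan_entry q i j \<and>
        enat (nat (- cartan_entry q i j)) < mult_order (q i i))"

definition nichols_cartan_type :: "'g monoid \<Rightarrow> ('g, 'i, 'k::field) yd \<Rightarrow> bool" where
  "nichols_cartan_type G Y \<longleftrightarrow>
     (\<exists>q. nichols_diagonal_type G Y q \<and> cartan_matrix_condition (basis Y) q)"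


section \<open>The Yetter--Drinfeld module of a cyclic group\<close>

definition primitive_root_of_unity :: "nat \<Rightarrow> 'k::field \<Rightarrow> bool" where
  "primitive_root_of_unity n x \<longleftrightarrow> n > 0 \<and> x ^ n = 1 \<and> (\<forall>m. 0 < m \<and> m < n \<longrightarrow> x ^ m \<noteq> 1)"

text \<open>
  The group \<open>C\<^sub>n\<close> is \<open>integer_mod_group n\<close>. For \<open>n \<ge> 2\<close> its generator \<open>g\<close> is the residue \<open>1\<close>, so
  the group element \<open>h \<in> {0..<n}\<close> is \<open>g\<^sup>h\<close>,
  which acts on each \<open>s\<^sub>i\<close> by \<open>\<xi>\<^sup>h\<close>.
\<close>

definition Y_cyclic :: "nat \<Rightarrow> 'k::field \<Rightarrow> (int, nat, 'k) yd" where
  "Y_cyclic n \<xi> =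
     \<lparr>basis = {1..n - 1},
      act = (\<lambda>h i. scale (\<xi> ^ nat h) (bvec i)),
      deg = (\<lambda>i. 1 [^]\<^bsub>integer_mod_group n\<^esub> i)\<rparr>"

lemma deg_Y_cyclic: "i < n \<Longrightarrow> deg (Y_cyclic n \<xi>) i = int i"
  by (simp add: Y_cyclic_def)

lemma lin_ext_scale [simp]: "lin_ext f (scale c (bvec b)) = scale c (f b)"
proof -
  have "scale c (bvec b) = Poly_Mapping.single b c"
    by (rule poly_mapping_eqI) (simp add: bvec_def lookup_single when_def)
  then show ?thesis by simp
qed

lemma yetter_drinfeld_Y_cyclic:
  assumes "n \<ge> 2" and "primitive_root_of_unity n \<xi>"
  shows "yetter_drinfeld (integer_mod_group n) (Y_cyclic n \<xi>)"
proof -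
  have xi: "\<xi> ^ n = 1" using assms by (simp add: primitive_root_of_unity_def)
  have pow: "\<xi> ^ (m mod n) = \<xi> ^ m" for m
  proof -
    have "\<xi> ^ m = \<xi> ^ (n * (m div n) + m mod n)" by simp
    also have "\<dots> = \<xi> ^ (m mod n)" by (simp only: power_add power_mult xi) simp
    finally show ?thesis by simp
  qed
  interpret group "integer_mod_group n" by simp
  have keys: "Poly_Mapping.keys (scale c (bvec i)) \<subseteq> {i}" for c :: 'a and i :: nat
    by (auto simp: in_keys_iff bvec_def lookup_single when_def split: if_splits)
  show ?thesis
  proof unfold_locales
    fix i assume i: "i \<in> basis (Y_cyclic n \<xi>)"
    show "deg (Y_cyclic n \<xi>) i \<in> carrier (integer_mod_group n)"
      using assms by (simp add: Y_cyclic_def carrier_integer_mod_group)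
    show "act (Y_cyclic n \<xi>) \<one>\<^bsub>integer_mod_group n\<^esub> i = bvec i"
      by (rule poly_mapping_eqI) (simp add: Y_cyclic_def)
    fix h assume h: "h \<in> carrier (integer_mod_group n)"
    show "act (Y_cyclic n \<xi>) h i \<in> lin_space (basis (Y_cyclic n \<xi>))"
      using i keys by (fastforce simp: Y_cyclic_def lin_space_def)
    have "(h + int i + (- h)) mod int n = int i mod int n" by simp
    then have "deg (Y_cyclic n \<xi>) i = h \<otimes>\<^bsub>integer_mod_group n\<^esub> deg (Y_cyclic n \<xi>) i
        \<otimes>\<^bsub>integer_mod_group n\<^esub> inv\<^bsub>integer_mod_group n\<^esub> h"
      using h by (simp add: Y_cyclic_def mod_simps)
    then show "act (Y_cyclic n \<xi>) h i \<in> lin_space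
        {j. deg (Y_cyclic n \<xi>) j = h \<otimes>\<^bsub>integer_mod_group n\<^esub> deg (Y_cyclic n \<xi>) i
          \<otimes>\<^bsub>integer_mod_group n\<^esub> inv\<^bsub>integer_mod_group n\<^esub> h}"
      using keys[of "\<xi> ^ nat h" i] by (auto simp: lin_space_def Y_cyclic_def)
    fix h' assume h': "h' \<in> carrier (integer_mod_group n)"
    have nonneg: "h \<ge> 0" "h' \<ge> 0"
      using h h' assms by (auto simp: carrier_integer_mod_group)
    then have "nat ((h + h') mod int n) = (nat h + nat h') mod n"
      by (simp add: nat_mod_distrib nat_add_distrib)
    then have "\<xi> ^ nat ((h + h') mod int n) = \<xi> ^ nat h * \<xi> ^ nat h'"
      by (simp add: pow power_add)
    then show "act (Y_cyclic n \<xi>) (h \<otimes>\<^bsub>integer_mod_group n\<^esub> h') i =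
        lin_ext (act (Y_cyclic n \<xi>) h) (act (Y_cyclic n \<xi>) h' i)"
      by (auto intro!: poly_mapping_eqI simp: Y_cyclic_def)
  qed
qed

lemma braiding_Y_cyclic:
  assumes "i < n"
  shows "braiding (Y_cyclic n \<xi>) (tensor (bvec i) (bvec j)) =
         scale (\<xi> ^ i) (tensor (bvec j) (bvec i))"
proof -
  have "braiding (Y_cyclic n \<xi>) (tensor (bvec i) (bvec j)) =
        tensor (scale (\<xi> ^ i) (bvec j)) (bvec i)"
    using assms by (simp add: braiding_def deg_Y_cyclic) (simp add: Y_cyclic_def)
  then show ?thesis by (simp add: tensor_def)
qed

end

theory Submission
  imports Defs "HOL-Number_Theory.Cong"
begin

text \<open>
  The theorem combines two facts of different nature.

  The first is that the only matrix describing the braiding of the generators inside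
  \<open>B(Y) \<otimes> B(Y)\<close> is \<open>q\<^sub>i\<^sub>j = \<xi>\<^sup>i\<close>. On words the braiding of \<open>T(Y)\<close> is
  \<open>v \<otimes> w \<mapsto> \<beta>(v, w) w \<otimes> v\<close>, where \<open>\<beta>(v, w) = \<xi>\<^sup>s\<^sup>l\<close> with \<open>s\<close> the sum of the letters of \<open>v\<close> and
  \<open>l\<close> the length of \<open>w\<close>. For a diagonal braiding the quantum symmetrizers send a word to a
  combination of its rearrangements, so they commute with every rescaling of words by a factor that
  depends only on the multiset of letters (\<open>total_sym_reweight\<close>). The scalar \<open>\<beta>\<close> is such a factor in
  each argument; therefore the braiding respects the relations of \<open>B(Y) \<otimes> B(Y)\<close>
  (\<open>twisted_flip_relations2\<close>) and descends to the quotient. Since \<open>S\<^sub>1\<close> is the identity, no element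
  of the Nichols ideal has a component of degree one (\<open>nichols_ideal_degree_one\<close>). Thus
  \<open>s\<^sub>j \<otimes> s\<^sub>i\<close> stays nonzero in the quotient and the scalars \<open>q\<^sub>i\<^sub>j\<close> can be read off
  (\<open>nichols_diagonal_type_iff\<close>).

  The second is arithmetic. The bound \<open>-a\<^sub>i\<^sub>j < ord q\<^sub>i\<^sub>i\<close> is automatic once \<open>a\<^sub>i\<^sub>j\<close> exists, because
  exponents can be reduced modulo the order, and \<open>q\<^sub>i\<^sub>i = \<xi>\<^sup>i\<close> is never \<open>1\<close> for \<open>0 < i < n\<close>. So
  Cartan type means that \<open>n dvd i r + i + j\<close> has a solution \<open>r\<close> for all distinct \<open>i, j\<close>. If \<open>n\<close> is
  prime, each \<open>i\<close> is invertible modulo \<open>n\<close>; if \<open>n\<close> has a proper divisor \<open>d > 1\<close>, then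
  \<open>i = d\<close>, \<open>j = 1\<close> has no solution modulo \<open>d\<close> (\<open>prime_iff_solvable\<close>).
\<close>

section \<open>Coordinates of linear extensions and tensors\<close>

lemma lookup_bvec: "Poly_Mapping.lookup (bvec b) c = (if b = c then 1 else 0)"
  by (simp add: bvec_def lookup_single when_def)

lemma keys_bvec [simp]: "Poly_Mapping.keys (bvec b :: 'b \<Rightarrow>\<^sub>0 'k::field) = {b}"
  by (simp add: bvec_def)

lemma keys_scale: "Poly_Mapping.keys (scale c v) \<subseteq> Poly_Mapping.keys v"
  by (auto simp: in_keys_iff)

lemma lookup_sum_scale:
  "Poly_Mapping.lookup (\<Sum>a\<in>A. scale (c a) (f a)) b = (\<Sum>a\<in>A. c a * Poly_Mapping.lookup (f a) b)"
  by (simp add: lookup_sum)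

lemma lookup_lin_ext:
  assumes "finite A" "Poly_Mapping.keys v \<subseteq> A"
  shows "Poly_Mapping.lookup (lin_ext f v) b =
    (\<Sum>a\<in>A. Poly_Mapping.lookup v a * Poly_Mapping.lookup (f a) b)"
  unfolding lin_ext_def lookup_sum_scale using assms
  by (intro sum.mono_neutral_left) (auto simp: in_keys_iff)

text \<open>
  Most maps below send basis vectors to multiples of basis vectors injectively, so that a single
  summand contributes to a given coordinate.
\<close>

lemma lookup_lin_ext_if:
  assumes "\<And>a. a \<noteq> d \<Longrightarrow> Poly_Mapping.lookup (f a) b = 0"
  shows "Poly_Mapping.lookup (lin_ext f v) b =
    Poly_Mapping.lookup v d * Poly_Mapping.lookup (f d) b"
proof -
  have "Poly_Mapping.lookup (lin_ext f v) b =
    (\<Sum>a\<in>insert d (Poly_Mapping.keys v). Poly_Mapping.lookup v a * Poly_Mapping.lookup (f a) b)"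
    by (rule lookup_lin_ext) auto
  also have "\<dots> = (\<Sum>a\<in>{d}. Poly_Mapping.lookup v a * Poly_Mapping.lookup (f a) b)"
    by (rule sum.mono_neutral_right) (auto simp: assms)
  finally show ?thesis by simp
qed

lemma lin_ext_add: "lin_ext f (v + w) = lin_ext f v + lin_ext f w"
proof (rule poly_mapping_eqI)
  fix b
  let ?A = "Poly_Mapping.keys v \<union> Poly_Mapping.keys w"
  have "Poly_Mapping.keys (v + w) \<subseteq> ?A" by (rule Poly_Mapping.keys_add)
  then show "Poly_Mapping.lookup (lin_ext f (v + w)) b = Poly_Mapping.lookup (lin_ext f v + lin_ext f w) b"
    by (simp add: lookup_add lookup_lin_ext[of ?A] distrib_right sum.distrib)
qed

lemma lin_ext_scale_vector: "lin_ext f (scale c v) = scale c (lin_ext f v)"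
  by (rule poly_mapping_eqI)
     (simp add: lookup_lin_ext[OF _ keys_scale] lookup_lin_ext[of "Poly_Mapping.keys v" v]
       sum_distrib_left mult.assoc)

lemma keys_lin_ext: "Poly_Mapping.keys (lin_ext f v) \<subseteq> (\<Union>b\<in>Poly_Mapping.keys v. Poly_Mapping.keys (f b))"
proof
  fix b assume "b \<in> Poly_Mapping.keys (lin_ext f v)"
  then have "(\<Sum>a\<in>Poly_Mapping.keys v. Poly_Mapping.lookup v a * Poly_Mapping.lookup (f a) b) \<noteq> 0"
    by (simp add: in_keys_iff lookup_lin_ext[of "Poly_Mapping.keys v"])
  then show "b \<in> (\<Union>b\<in>Poly_Mapping.keys v. Poly_Mapping.keys (f b))"
    by (metis (mono_tags, lifting) UN_I in_keys_iff mult_zero_right sum.neutral)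
qed

lemma keys_lin_ext_subset:
  assumes "\<And>b. b \<in> Poly_Mapping.keys v \<Longrightarrow> Poly_Mapping.keys (f b) \<subseteq> A"
  shows "Poly_Mapping.keys (lin_ext f v) \<subseteq> A"
  using keys_lin_ext[of f v] assms by blast

lemma lookup_tensor:
  "Poly_Mapping.lookup (tensor v w) (b, c) = Poly_Mapping.lookup v b * Poly_Mapping.lookup w c"
proof -
  have "Poly_Mapping.lookup (lin_ext (\<lambda>c. bvec (a, c)) w) (b, c)
      = (if a = b then Poly_Mapping.lookup w c else 0)" for a
    by (subst lookup_lin_ext_if[where d = c]) (auto simp: lookup_bvec)
  then show ?thesis
    unfolding tensor_def by (subst lookup_lin_ext_if[where d = b]) auto
qed

section \<open>Quantum symmetrizers of diagonal braidings\<close>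

text \<open>
  When every basis vector is an eigenvector of every group element, the braiding swaps two letters up
  to a scalar. The condition ranges over all indices, not only over the basis, so that the results
  below hold for arbitrary words.
\<close>

definition diagonal_action :: "('g, 'i, 'k::field) yd \<Rightarrow> bool" where
  "diagonal_action Y \<longleftrightarrow> (\<forall>h i. \<exists>c. act Y h i = scale c (bvec i))"

abbreviation rearrangements :: "'i list \<Rightarrow> 'i list set" where
  "rearrangements w \<equiv> {v. mset v = mset w}"

lemma keys_braid_at:
  assumes "diagonal_action Y" "Suc m < length w"
  shows "Poly_Mapping.keys (braid_at Y m w) \<subseteq> rearrangements w"
proof -
  obtain c where c: "act Y (deg Y (w ! m)) (w ! Suc m) = scale c (bvec (w ! Suc m))"
    using assms(1) unfolding diagonal_action_def by blast
  have split: "w = take m w @ [w ! m, w ! Suc m] @ drop (m + 2) w"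
    using assms(2) by (simp add: Cons_nth_drop_Suc)
  have "mset w = mset (take m w @ [w ! Suc m, w ! m] @ drop (m + 2) w)"
    by (rule trans[OF arg_cong[OF split, of mset]]) simp
  moreover have "braid_at Y m w = scale c (bvec (take m w @ [w ! Suc m, w ! m] @ drop (m + 2) w))"
    unfolding braid_at_def by (simp add: braiding_def c tensor_def)
  ultimately show ?thesis
    using keys_scale[of c "bvec (take m w @ [w ! Suc m, w ! m] @ drop (m + 2) w)"] by auto
qed

lemma keys_to_front:
  assumes "diagonal_action Y" "m < length w"
  shows "Poly_Mapping.keys (to_front Y m w) \<subseteq> rearrangements w"
  using assms(2)
proof (induction m arbitrary: w)
  case (Suc m)
  have "Poly_Mapping.keys (to_front Y m v) \<subseteq> rearrangements w"
    if "v \<in> Poly_Mapping.keys (braid_at Y m w)" for v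
  proof -
    have "mset v = mset w" using keys_braid_at[OF assms(1) Suc.prems] that by auto
    then show ?thesis using Suc.IH[of v] Suc.prems by (metis Suc_lessD mset_eq_length)
  qed
  then show ?case by (simp add: keys_lin_ext_subset)
qed auto

text \<open>
  Each summand of the symmetrizer is a composite of adjacent swaps with scalars.
\<close>

lemma keys_quantum_sym:
  assumes "diagonal_action Y"
  shows "Poly_Mapping.keys (quantum_sym Y (length w) w) \<subseteq> rearrangements w"
proof (induction "length w" arbitrary: w)
  case (Suc m)
  have "Poly_Mapping.keys (id_tensor (quantum_sym Y m) v) \<subseteq> rearrangements w"
    if v_key: "v \<in> Poly_Mapping.keys (\<Sum>l\<le>m. to_front Y l w)" for v
  proof -
    obtain l where "l \<le> m" "v \<in> Poly_Mapping.keys (to_front Y l w)"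
      using subsetD[OF Poly_Mapping.keys_sum v_key] by blast
    then have v: "mset v = mset w" using keys_to_front[OF assms, of l w] Suc(2) by auto
    then have "length v = Suc m" using Suc(2) by (metis mset_eq_length)
    then obtain i u where iu: "v = i # u" "length u = m" by (cases v) auto
    show ?thesis
    proof
      fix x assume "x \<in> Poly_Mapping.keys (id_tensor (quantum_sym Y m) v)"
      then obtain a b where ab: "(a, b) \<in> Poly_Mapping.keys (tensor (bvec i) (quantum_sym Y m u))"
          "x = a # b"
        using keys_lin_ext[of word_cons "tensor (bvec i) (quantum_sym Y m u)"]
        by (auto simp: iu word_cons_def split: prod.splits)
      then have "a = i" "b \<in> Poly_Mapping.keys (quantum_sym Y m u)"
        by (auto simp: in_keys_iff lookup_tensor lookup_bvec split: if_splits)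
      then show "x \<in> rearrangements w" using Suc(1)[of u] iu ab v by auto
    qed
  qed
  then show ?case
    unfolding Suc(2)[symmetric] quantum_sym.simps by (rule keys_lin_ext_subset)
qed auto

section \<open>Defining ideal of the Nichols algebra\<close>

text \<open>
  The map whose kernel is the Nichols ideal: the sum of the symmetrizers of all degrees.
\<close>

abbreviation total_sym :: "('g, 'i, 'k::field) yd \<Rightarrow> ('i list \<Rightarrow>\<^sub>0 'k) \<Rightarrow> ('i list \<Rightarrow>\<^sub>0 'k)" where
  "total_sym Y \<equiv> lin_ext (\<lambda>w. quantum_sym Y (length w) w)"

definition reweight :: "('b \<Rightarrow> 'k::field) \<Rightarrow> ('b \<Rightarrow>\<^sub>0 'k) \<Rightarrow> ('b \<Rightarrow>\<^sub>0 'k)" where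
  "reweight \<phi> = lin_ext (\<lambda>b. scale (\<phi> b) (bvec b))"

lemma lookup_reweight: "Poly_Mapping.lookup (reweight \<phi> v) b = \<phi> b * Poly_Mapping.lookup v b"
  unfolding reweight_def by (subst lookup_lin_ext_if[where d = b]) (auto simp: lookup_bvec)

text \<open>
  The matrix entry of the symmetrizer from \<open>w\<close> to \<open>u\<close> vanishes unless \<open>u\<close> is a rearrangement of
  \<open>w\<close>, and then both words carry the same weight.
\<close>

lemma total_sym_reweight:
  assumes "diagonal_action Y" and inv: "\<And>v w. mset v = mset w \<Longrightarrow> \<phi> v = \<phi> w"
  shows "total_sym Y (reweight \<phi> x) = reweight \<phi> (total_sym Y x)"
proof (rule poly_mapping_eqI)
  fix u
  let ?S = "\<lambda>w. Poly_Mapping.lookup (quantum_sym Y (length w) w) u"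
  have swap: "\<phi> w * ?S w = \<phi> u * ?S w" for w
    using keys_quantum_sym[OF assms(1), of w] inv[of u w] by (cases "?S w = 0") (auto simp: in_keys_iff)
  have "Poly_Mapping.keys (reweight \<phi> x) \<subseteq> Poly_Mapping.keys x"
    by (auto simp: in_keys_iff lookup_reweight)
  then have "Poly_Mapping.lookup (total_sym Y (reweight \<phi> x)) u =
      (\<Sum>w\<in>Poly_Mapping.keys x. Poly_Mapping.lookup x w * (\<phi> w * ?S w))"
    by (simp add: lookup_lin_ext[of "Poly_Mapping.keys x"] lookup_reweight mult_ac)
  also have "\<dots> = \<phi> u * (\<Sum>w\<in>Poly_Mapping.keys x. Poly_Mapping.lookup x w * ?S w)"
    by (simp add: swap sum_distrib_left mult_ac)
  finally show "Poly_Mapping.lookup (total_sym Y (reweight \<phi> x)) u =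
      Poly_Mapping.lookup (reweight \<phi> (total_sym Y x)) u"
    by (simp add: lookup_lin_ext[of "Poly_Mapping.keys x" x] lookup_reweight)
qed

text \<open>
  In the cyclic case this yields stability of the ideal under the coaction (weights depending on the
  sum of the letters) and under the action (weights depending on the length).
\<close>

lemma reweight_nichols_ideal:
  assumes "diagonal_action Y" "\<And>v w. mset v = mset w \<Longrightarrow> \<phi> v = \<phi> w" "x \<in> nichols_ideal Y"
  shows "reweight \<phi> x \<in> nichols_ideal Y"
proof -
  have "total_sym Y x = 0" using assms(3) by (simp add: nichols_ideal_def)
  moreover have "total_sym Y (reweight \<phi> x) = reweight \<phi> (total_sym Y x)"
    by (rule total_sym_reweight[OF assms(1)]) (rule assms(2))
  ultimately have "total_sym Y (reweight \<phi> x) = 0"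
    by (simp add: reweight_def lin_ext_def)
  then show ?thesis
    using assms(3) by (auto simp: nichols_ideal_def lin_space_def in_keys_iff lookup_reweight)
qed

text \<open>
  The word \<open>[j]\<close> is its own only rearrangement and \<open>S\<^sub>1\<close> is the identity, so the coefficient of \<open>[j]\<close>
  is the same before and after symmetrization.
\<close>

lemma nichols_ideal_degree_one:
  assumes "diagonal_action Y" "x \<in> nichols_ideal Y"
  shows "Poly_Mapping.lookup x [j] = 0"
proof -
  have "Poly_Mapping.lookup (quantum_sym Y (length w) w) [j] = 0" if "w \<noteq> [j]" for w
    using keys_quantum_sym[OF assms(1), of w] that by (auto simp: in_keys_iff)
  then have "Poly_Mapping.lookup (total_sym Y x) [j] =
      Poly_Mapping.lookup x [j] * Poly_Mapping.lookup (quantum_sym Y (length [j]) [j]) [j]"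
    by (rule lookup_lin_ext_if)
  also have "quantum_sym Y (length [j]) [j] = bvec [j]"
    by (simp add: word_cons_def)
  finally show ?thesis using assms(2) by (simp add: nichols_ideal_def lookup_bvec)
qed

section \<open>Induced braiding on the Nichols algebra\<close>

interpretation scale: vector_space scale
  by (rule vector_space_scale)

lemma tensor_in_relations2:
  assumes "x \<in> nichols_ideal Y" "y \<in> lin_space (lists (basis Y))"
  shows "tensor x y \<in> nichols_relations2 Y" "tensor y x \<in> nichols_relations2 Y"
  unfolding nichols_relations2_def using assms by (auto intro!: scale.span_base)

lemma subspace_relations2: "scale.subspace (nichols_relations2 Y)"
  unfolding nichols_relations2_def by (rule scale.subspace_span)

text \<open>
  This is what makes the scalars \<open>q\<^sub>i\<^sub>j\<close> unique: the coefficient at \<open>s\<^sub>i \<otimes> s\<^sub>j\<close> is a well-defined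
  linear form on the quotient. On each spanning tensor of the relations it has as a factor a degree one
  coefficient of an element of the ideal.
\<close>

lemma relations2_degree_one:
  assumes "diagonal_action Y" "t \<in> nichols_relations2 Y"
  shows "Poly_Mapping.lookup t ([i], [j]) = 0"
  using assms(2) unfolding nichols_relations2_def
proof (induction rule: scale.span_induct_alt)
  case (step c t u)
  then show ?case
    by (auto simp: lookup_add lookup_tensor nichols_ideal_degree_one[OF assms(1)])
qed simp

definition twisted_flip ::
    "('b \<Rightarrow> 'b \<Rightarrow> 'k::field) \<Rightarrow> ('b \<times> 'b \<Rightarrow>\<^sub>0 'k) \<Rightarrow> ('b \<times> 'b \<Rightarrow>\<^sub>0 'k)" where
  "twisted_flip \<beta> = lin_ext (\<lambda>(v, w). scale (\<beta> v w) (bvec (w, v)))"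

lemma lookup_twisted_flip:
  "Poly_Mapping.lookup (twisted_flip \<beta> t) (w, v) = \<beta> v w * Poly_Mapping.lookup t (v, w)"
  unfolding twisted_flip_def
  by (subst lookup_lin_ext_if[where d = "(v, w)"]) (auto simp: lookup_bvec split: prod.splits)

text \<open>
  Expanding one factor of \<open>x \<otimes> y\<close> into words turns the other factor into a rescaled copy of itself.
  Both expansions are needed, since the factor from the ideal, which must not be expanded, can be
  either one.
\<close>

lemma twisted_flip_tensor_left:
  "twisted_flip \<beta> (tensor x y) =
    (\<Sum>w\<in>Poly_Mapping.keys y. scale (Poly_Mapping.lookup y w)
      (tensor (bvec w) (reweight (\<lambda>v. \<beta> v w) x)))" (is "_ = ?R")
proof (rule poly_mapping_eqI)
  fix p :: "'a \<times> 'a"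
  obtain u v where p: "p = (u, v)" by fastforce
  have "Poly_Mapping.lookup ?R (u, v) =
      (\<Sum>w\<in>Poly_Mapping.keys y. if w = u then Poly_Mapping.lookup y u * (\<beta> v u * Poly_Mapping.lookup x v) else 0)"
    unfolding lookup_sum_scale
    by (intro sum.cong) (auto simp: lookup_tensor lookup_bvec lookup_reweight)
  also have "\<dots> = Poly_Mapping.lookup y u * (\<beta> v u * Poly_Mapping.lookup x v)"
    by (simp add: sum.delta in_keys_iff)
  finally show "Poly_Mapping.lookup (twisted_flip \<beta> (tensor x y)) p = Poly_Mapping.lookup ?R p"
    by (simp add: p lookup_twisted_flip lookup_tensor mult_ac)
qed

lemma twisted_flip_tensor_right:
  "twisted_flip \<beta> (tensor x y) =
    (\<Sum>v\<in>Poly_Mapping.keys x. scale (Poly_Mapping.lookup x v)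
      (tensor (reweight (\<beta> v) y) (bvec v)))" (is "_ = ?R")
proof (rule poly_mapping_eqI)
  fix p :: "'a \<times> 'a"
  obtain w u where p: "p = (w, u)" by fastforce
  have "Poly_Mapping.lookup ?R (w, u) =
      (\<Sum>v\<in>Poly_Mapping.keys x. if v = u then Poly_Mapping.lookup x u * (\<beta> u w * Poly_Mapping.lookup y w) else 0)"
    unfolding lookup_sum_scale
    by (intro sum.cong) (auto simp: lookup_tensor lookup_bvec lookup_reweight)
  also have "\<dots> = Poly_Mapping.lookup x u * (\<beta> u w * Poly_Mapping.lookup y w)"
    by (simp add: sum.delta in_keys_iff)
  finally show "Poly_Mapping.lookup (twisted_flip \<beta> (tensor x y)) p = Poly_Mapping.lookup ?R p"
    by (simp add: p lookup_twisted_flip lookup_tensor mult_ac)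
qed

text \<open>
  The flip exchanges the two kinds of spanning tensors, and the ideal absorbs the weights.
\<close>

lemma twisted_flip_relations2:
  fixes \<beta> :: "'i list \<Rightarrow> 'i list \<Rightarrow> 'k::field"
  assumes "diagonal_action Y"
    and inv1: "\<And>v v' w. mset v = mset v' \<Longrightarrow> \<beta> v w = \<beta> v' w"
    and inv2: "\<And>v w w'. mset w = mset w' \<Longrightarrow> \<beta> v w = \<beta> v w'"
    and "t \<in> nichols_relations2 Y"
  shows "twisted_flip \<beta> t \<in> nichols_relations2 Y"
  using assms(4)
  unfolding nichols_relations2_def[of Y]
proof (induction rule: scale.span_induct_alt)
  case base
  show ?case by (simp add: twisted_flip_def lin_ext_def scale.span_zero)
next
  case (step c t u)
  have word: "bvec w \<in> lin_space (lists (basis Y))"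
    if "y \<in> lin_space (lists (basis Y))" "w \<in> Poly_Mapping.keys y" for w and y :: "'i list \<Rightarrow>\<^sub>0 'k"
    using that by (auto simp: lin_space_def)
  from step(1) consider
      x y where "t = tensor x y" "x \<in> nichols_ideal Y" "y \<in> lin_space (lists (basis Y))"
    | x y where "t = tensor x y" "x \<in> lin_space (lists (basis Y))" "y \<in> nichols_ideal Y"
    by blast
  then have "twisted_flip \<beta> t \<in> nichols_relations2 Y"
  proof cases
    case 1
    then show ?thesis
      unfolding 1(1) twisted_flip_tensor_left
      by (intro scale.subspace_sum scale.subspace_scale subspace_relations2 tensor_in_relations2
            reweight_nichols_ideal assms(1) word[OF 1(3)] inv1)
  next
    case 2
    then show ?thesis
      unfolding 2(1) twisted_flip_tensor_right
      by (intro scale.subspace_sum scale.subspace_scale subspace_relations2 tensor_in_relations2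
            reweight_nichols_ideal assms(1) word[OF 2(2)] inv2)
  qed
  moreover have "twisted_flip \<beta> u \<in> nichols_relations2 Y"
    using step(2) unfolding nichols_relations2_def .
  ultimately have "scale c (twisted_flip \<beta> t) + twisted_flip \<beta> u \<in> nichols_relations2 Y"
    by (intro scale.subspace_add scale.subspace_scale subspace_relations2)
  then show ?case
    unfolding nichols_relations2_def by (simp add: twisted_flip_def lin_ext_add lin_ext_scale_vector)
qed

lemma mem_nichols_class2: "s \<in> nichols_class2 Y t \<longleftrightarrow> s - t \<in> nichols_relations2 Y"
  unfolding nichols_class2_def by (auto intro!: exI[of _ "s - t"])

lemma nichols_class2_eq_iff:
  "nichols_class2 Y s = nichols_class2 Y t \<longleftrightarrow> s - t \<in> nichols_relations2 Y"
proof
  assume "nichols_class2 Y s = nichols_class2 Y t"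
  moreover have "s \<in> nichols_class2 Y s"
    by (simp add: mem_nichols_class2 scale.subspace_0[OF subspace_relations2])
  ultimately show "s - t \<in> nichols_relations2 Y" by (simp add: mem_nichols_class2)
next
  assume st: "s - t \<in> nichols_relations2 Y"
  have "u - s \<in> nichols_relations2 Y \<longleftrightarrow> u - t \<in> nichols_relations2 Y" for u
    using scale.subspace_add[OF subspace_relations2 _ st, of "u - s"]
      scale.subspace_diff[OF subspace_relations2 _ st, of "u - t"] by auto
  then show "nichols_class2 Y s = nichols_class2 Y t" by (auto simp: mem_nichols_class2)
qed

text \<open>
  The braiding descends to cosets because it preserves the relations; comparing the coefficients of
  \<open>s\<^sub>j \<otimes> s\<^sub>i\<close> in two representatives then determines the scalar.
\<close>

lemma nichols_diagonal_type_iff: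
  assumes "diagonal_action Y"
    and inv1: "\<And>v v' w. mset v = mset v' \<Longrightarrow> \<beta> v w = \<beta> v' w"
    and inv2: "\<And>v w w'. mset w = mset w' \<Longrightarrow> \<beta> v w = \<beta> v w'"
    and braiding: "braiding (tensor_algebra G Y) = twisted_flip \<beta>"
  shows "nichols_diagonal_type G Y q \<longleftrightarrow> (\<forall>i\<in>basis Y. \<forall>j\<in>basis Y. q i j = \<beta> [i] [j])"
proof -
  have "nichols_braiding G Y (nichols_class2 Y t) = nichols_class2 Y (twisted_flip \<beta> t)" for t
  proof -
    have "nichols_class2 Y (twisted_flip \<beta> s) = nichols_class2 Y (twisted_flip \<beta> t)"
      if "s \<in> nichols_class2 Y t" for s
    proof -
      obtain r where "s = t + r" "r \<in> nichols_relations2 Y"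
        using \<open>s \<in> _\<close> unfolding nichols_class2_def by blast
      moreover have "twisted_flip \<beta> r \<in> nichols_relations2 Y"
        using assms(1) inv1 inv2 \<open>r \<in> _\<close> by (rule twisted_flip_relations2)
      ultimately show ?thesis
        unfolding nichols_class2_eq_iff by (simp add: twisted_flip_def lin_ext_add)
    qed
    moreover have "t \<in> nichols_class2 Y t"
      by (simp add: mem_nichols_class2 scale.subspace_0[OF subspace_relations2])
    ultimately show ?thesis unfolding nichols_braiding_def braiding by blast
  qed
  moreover have "twisted_flip \<beta> (bvec ([i], [j])) - scale c (bvec ([j], [i])) \<in> nichols_relations2 Y
      \<longleftrightarrow> c = \<beta> [i] [j]" for i j c
  proof
    assume "twisted_flip \<beta> (bvec ([i], [j])) - scale c (bvec ([j], [i])) \<in> nichols_relations2 Y"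
    from relations2_degree_one[OF assms(1) this, of j i] show "c = \<beta> [i] [j]"
      by (simp add: lookup_minus lookup_twisted_flip lookup_bvec)
  qed (simp add: twisted_flip_def scale.subspace_0[OF subspace_relations2])
  ultimately show ?thesis
    by (simp add: nichols_diagonal_type_def nichols_class2_eq_iff)
qed

section \<open>The braiding over a cyclic group\<close>

lemma power_mod_exponent:
  fixes x :: "'a::monoid_mult"
  assumes "x ^ n = 1"
  shows "x ^ (m mod n) = x ^ m"
proof -
  have "x ^ m = x ^ (n * (m div n) + m mod n)" by simp
  also have "\<dots> = x ^ (m mod n)" by (simp only: power_add power_mult assms) simp
  finally show ?thesis by simp
qed

lemma power_eq_1_iff_dvd:
  assumes "primitive_root_of_unity n \<xi>"
  shows "\<xi> ^ m = 1 \<longleftrightarrow> n dvd m"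
proof -
  have n: "n > 0" "\<xi> ^ n = 1" and min: "\<And>m. 0 < m \<Longrightarrow> m < n \<Longrightarrow> \<xi> ^ m \<noteq> 1"
    using assms by (auto simp: primitive_root_of_unity_def)
  have "\<xi> ^ m = 1 \<longleftrightarrow> \<xi> ^ (m mod n) = 1" by (simp add: power_mod_exponent n)
  also have "\<dots> \<longleftrightarrow> n dvd m" using min[of "m mod n"] n(1) by (auto simp: dvd_eq_mod_eq_0)
  finally show ?thesis .
qed

lemma word_act_Y_cyclic:
  "word_act (Y_cyclic n \<xi>) h w = scale ((\<xi> ^ nat h) ^ length w) (bvec w)"
proof (induction w)
  case (Cons i w)
  have "tensor (scale c (bvec i)) (scale d (bvec w)) = scale (c * d) (bvec (i, w))" for c d :: 'a
    by (rule poly_mapping_eqI) (auto simp: lookup_tensor lookup_bvec split: if_splits)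
  with Cons show ?case by (simp add: Y_cyclic_def word_cons_def)
qed (rule poly_mapping_eqI, simp)

lemma deg_word_Y_cyclic:
  assumes "n > 0"
  shows "deg (tensor_algebra (integer_mod_group n) (Y_cyclic n \<xi>)) w = int (sum_list w mod n)"
  by (induction w) (simp_all add: tensor_algebra_def Y_cyclic_def zmod_int mod_simps)

lemma braiding_tensor_algebra_Y_cyclic:
  assumes "primitive_root_of_unity n \<xi>"
  shows "braiding (tensor_algebra (integer_mod_group n) (Y_cyclic n \<xi>)) =
    twisted_flip (\<lambda>v w. (\<xi> ^ sum_list v) ^ length w)"
proof -
  have "n > 0" "\<xi> ^ n = 1" using assms by (simp_all add: primitive_root_of_unity_def)
  then have "tensor (act (tensor_algebra (integer_mod_group n) (Y_cyclic n \<xi>))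
        (deg (tensor_algebra (integer_mod_group n) (Y_cyclic n \<xi>)) v) w) (bvec v) =
      scale ((\<xi> ^ sum_list v) ^ length w) (bvec (w, v))" for v w
    unfolding deg_word_Y_cyclic[OF \<open>n > 0\<close>]
    by (simp add: tensor_algebra_def word_act_Y_cyclic power_mod_exponent[OF \<open>\<xi> ^ n = 1\<close>] tensor_def)
  then show ?thesis by (simp add: braiding_def twisted_flip_def)
qed

lemma nichols_diagonal_type_Y_cyclic:
  assumes "primitive_root_of_unity n \<xi>"
  shows "nichols_diagonal_type (integer_mod_group n) (Y_cyclic n \<xi>) q \<longleftrightarrow>
    (\<forall>i\<in>{1..n-1}. \<forall>j\<in>{1..n-1}. q i j = \<xi> ^ i)"
proof -
  have "diagonal_action (Y_cyclic n \<xi>)"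
    by (auto simp: diagonal_action_def Y_cyclic_def)
  note iff = nichols_diagonal_type_iff[OF this _ _ braiding_tensor_algebra_Y_cyclic[OF assms]]
  have "nichols_diagonal_type (integer_mod_group n) (Y_cyclic n \<xi>) q \<longleftrightarrow>
    (\<forall>i\<in>basis (Y_cyclic n \<xi>). \<forall>j\<in>basis (Y_cyclic n \<xi>).
      q i j = (\<xi> ^ sum_list [i]) ^ length [j])"
  proof (rule iff)
    show "(\<xi> ^ sum_list v) ^ length w = (\<xi> ^ sum_list v') ^ length w"
      if "mset v = mset v'" for v v' w :: "nat list"
      using that by (metis sum_mset_sum_list)
    show "(\<xi> ^ sum_list v) ^ length w = (\<xi> ^ sum_list v) ^ length w'"
      if "mset w = mset w'" for v w w' :: "nat list"
      using that by (metis mset_eq_length)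
  qed
  then show ?thesis by (simp add: Y_cyclic_def)
qed

section \<open>The Cartan condition as a divisibility problem\<close>

text \<open>
  Reducing the exponent modulo any \<open>m > 0\<close> with \<open>x\<^sup>m = 1\<close> gives another solution, so the least
  solution lies below every such \<open>m\<close>. If there is no such \<open>m\<close>, the order is \<open>\<infinity>\<close>.
\<close>

lemma Least_solution_less_mult_order:
  assumes "\<exists>r. x ^ r * y * z = 1"
  shows "enat (LEAST r. x ^ r * y * z = 1) < mult_order x"
proof -
  let ?L = "LEAST r. x ^ r * y * z = 1"
  have "Suc ?L \<le> m" if "m > 0" "x ^ m = 1" for m
  proof -
    have "x ^ (?L mod m) * y * z = 1"
      using LeastI_ex[OF assms] by (simp add: power_mod_exponent[OF that(2)])
    then have "?L \<le> ?L mod m" by (rule Least_le)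
    also have "\<dots> < m" using that(1) by simp
    finally show ?thesis by simp
  qed
  then have "enat (Suc ?L) \<le> mult_order x"
    unfolding mult_order_def by (intro INF_greatest) auto
  then show ?thesis using less_le_trans[of "enat ?L" "enat (Suc ?L)"] by simp
qed

lemma cartan_matrix_condition_iff:
  "cartan_matrix_condition I q \<longleftrightarrow>
    (\<forall>i\<in>I. q i i \<noteq> 1) \<and> (\<forall>i\<in>I. \<forall>j\<in>I. i \<noteq> j \<longrightarrow> (\<exists>r. q i i ^ r * q i j * q j i = 1))"
  unfolding cartan_matrix_condition_def cartan_entry_def
  using Least_solution_less_mult_order by fastforce

lemma cartan_matrix_condition_cong:
  assumes "\<And>i j. i \<in> I \<Longrightarrow> j \<in> I \<Longrightarrow> q i j = q' i j"
  shows "cartan_matrix_condition I q \<longleftrightarrow> cartan_matrix_condition I q'"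
  unfolding cartan_matrix_condition_iff by (simp add: assms cong: ball_cong)

lemma prime_iff_solvable:
  fixes n :: nat
  assumes "n \<ge> 2"
  shows "prime n \<longleftrightarrow> (\<forall>i\<in>{1..n-1}. \<forall>j\<in>{1..n-1}. i \<noteq> j \<longrightarrow> (\<exists>r. n dvd i * r + i + j))"
    (is "_ \<longleftrightarrow> ?solvable")
proof
  assume "prime n"
  show ?solvable
  proof (intro ballI impI)
    fix i j assume "i \<in> {1..n-1}" "j \<in> {1..n-1}"
    then have "coprime i n"
      using \<open>prime n\<close> by (metis One_nat_def Suc_le_eq Suc_pred atLeastAtMost_iff coprime_commute
        less_Suc_eq_le nat_dvd_not_less prime_gt_0_nat prime_imp_coprime)
    then obtain s where s: "[i * s = 1] (mod n)" using cong_solve_coprime_nat by auto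
    \<comment> \<open>The solution is \<open>- (i + j) / i\<close>, with \<open>n - 1\<close> playing the role of \<open>-1\<close>.\<close>
    have "[i * (s * ((n - 1) * (i + j))) + i + j = 1 * ((n - 1) * (i + j)) + (i + j)] (mod n)"
      using cong_add[OF cong_mult[OF s cong_refl] cong_refl, of "(n - 1) * (i + j)" "i + j"]
      by (simp add: mult.assoc add.assoc)
    also have "1 * ((n - 1) * (i + j)) + (i + j) = n * (i + j)"
      using assms by (cases n) auto
    also have "[n * (i + j) = 0] (mod n)" by (simp add: cong_0_iff)
    finally show "\<exists>r. n dvd i * r + i + j" unfolding cong_0_iff by blast
  qed
next
  assume solvable: ?solvable
  show "prime n"
  proof (rule ccontr)
    assume "\<not> prime n"
    then obtain d where d: "d dvd n" "d \<noteq> 1" "d \<noteq> n"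
      using assms by (auto simp: prime_nat_iff)
    then have "1 < d" "d < n"
      using assms dvd_imp_le[of d n] by (auto intro: Nat.gr0I le_neq_implies_less simp: Suc_lessI)
    then have "d \<le> n - 1" "d \<noteq> 1" "1 \<le> n - 1" by simp_all
    then obtain r where "n dvd d * r + d + 1"
      using \<open>1 < d\<close> solvable[THEN bspec[of _ _ d], THEN bspec[of _ _ 1]] by fastforce
    then have "d dvd d * r + d + 1" using d(1) dvd_trans by blast
    then have "d dvd 1" by (metis dvd_add_right_iff dvd_triv_left dvd_refl dvd_add)
    then show False using d by simp
  qed
qed

theorem lemma2p2:
  fixes n :: nat and \<xi> :: "'k::field_char_0"
  assumes "n \<ge> 2"
    and "primitive_root_of_unity n \<xi>"
  shows "nichols_cartan_type (integer_mod_group n) (Y_cyclic n \<xi>) \<longleftrightarrow> prime n"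
proof -
  let ?I = "{1..n-1}"
  have "nichols_cartan_type (integer_mod_group n) (Y_cyclic n \<xi>) \<longleftrightarrow>
      (\<exists>q. (\<forall>i\<in>?I. \<forall>j\<in>?I. q i j = \<xi> ^ i) \<and> cartan_matrix_condition ?I q)"
    unfolding nichols_cartan_type_def nichols_diagonal_type_Y_cyclic[OF assms(2)]
    by (simp add: Y_cyclic_def)
  also have "\<dots> \<longleftrightarrow> cartan_matrix_condition ?I (\<lambda>i j. \<xi> ^ i)"
  proof -
    have "cartan_matrix_condition ?I q \<longleftrightarrow> cartan_matrix_condition ?I (\<lambda>i j. \<xi> ^ i)"
      if "\<forall>i\<in>?I. \<forall>j\<in>?I. q i j = \<xi> ^ i" for q
      using that by (intro cartan_matrix_condition_cong) auto
    moreover have "\<exists>q. \<forall>i\<in>?I. \<forall>j\<in>?I. q i j = \<xi> ^ i" by (rule exI[of _ "\<lambda>i j. \<xi> ^ i"]) simp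
    ultimately show ?thesis by blast
  qed
  also have "\<dots> \<longleftrightarrow> (\<forall>i\<in>?I. \<forall>j\<in>?I. i \<noteq> j \<longrightarrow> (\<exists>r. n dvd i * r + i + j))"
  proof -
    have "(\<xi> ^ i) ^ r * \<xi> ^ i * \<xi> ^ j = 1 \<longleftrightarrow> n dvd i * r + i + j" for i j r
      by (simp add: power_eq_1_iff_dvd[OF assms(2), symmetric] power_add power_mult)
    moreover have "\<xi> ^ i \<noteq> 1" if "i \<in> ?I" for i
      using that by (auto simp: power_eq_1_iff_dvd[OF assms(2)] dest!: dvd_imp_le)
    ultimately show ?thesis unfolding cartan_matrix_condition_iff by (simp only:) blast
  qed
  also have "\<dots> \<longleftrightarrow> prime n"
    using prime_iff_solvable[OF assms(1)] by simp
  finally show ?thesis .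
qed

end
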